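(* Let $n$ be a positive integer, $p\in\mathbb{N}_0$ and $x\in\mathbb{C}$ with $x\neq p-1$. Then \[ \sum_{k=1}^n\frac{\binom{x+k}{k}}{\binom{p+k}{k}}H_{p+k} =\frac{x+1}{x-p+1}\left\{\frac{\binom{x+n+1}{n}}{\binom{p+n}{n}}\left(H_{p+n}-\frac{1}{x-p+1}\right)-H_{p}+\frac{1}{x-p+1}\right\}. \]
   Context: $H_0=0$ and $H_m=\sum_{j=1}^m \frac1j$ for $m\ge1$ (harmonic numbers). For $z\in\mathbb{C}$ and $k\in\mathbb{N}_0$, $\binom{z}{k}=\frac{z(z-1)\cdots(z-k+1)}{k!}$. *)

theory Defs
  imports "HOL-Analysis.Harmonic_Numbers"
begin

end

theory Submission
  imports Defs
begin

lemma gbinomial_Suc_ratio: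
  fixes a :: "'a::field_char_0"
  shows "a gchoose Suc k = (a - of_nat k) / of_nat (Suc k) * (a gchoose k)"
  using gbinomial_mult_1[of a k] by (simp add: field_simps del: of_nat_Suc)

lemma gbinomial_absorption_ratio:
  fixes a :: "'a::field_char_0"
  shows "(a + 1) gchoose Suc k = (a + 1) / of_nat (Suc k) * (a gchoose k)"
  using gbinomial_absorption[of k "a + 1"] by (simp add: field_simps del: of_nat_Suc)

text \<open>The sum telescopes: the bracket on the right-hand side is a discrete antiderivative of the
  summand, so induction from the empty sum reduces everything to the ratios of consecutive
  binomial coefficients.\<close>

theorem theorem1:
  fixes n p :: nat and x :: complex
  assumes "n > 0" and "x \<noteq> of_nat p - 1"
  shows "(\<Sum>k=1..n. ((x + of_nat k) gchoose k) / (of_nat (p + k) gchoose k) * harm (p + k)) =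
    (x + 1) / (x - of_nat p + 1) *
      (((x + of_nat n + 1) gchoose n) / (of_nat (p + n) gchoose n) *
          (harm (p + n) - 1 / (x - of_nat p + 1))
        - harm p + 1 / (x - of_nat p + 1))"
proof (induction n)
  case 0
  show ?case by simp
next
  case (Suc n)
  \<comment> \<open>In these atoms the induction step becomes a rational identity whose denominators
    are built from \<open>c\<close>, \<open>q\<close>, \<open>m\<close> and \<open>D\<close>
    only.\<close>
  define c where "c = x - of_nat p + 1"
  define q where "q = (of_nat (p + n) + 1 :: complex)"
  define m where "m = (of_nat (Suc n) :: complex)"
  define B where "B = (x + of_nat n + 1) gchoose n"
  define D where "D = (of_nat (p + n) :: complex) gchoose n"
  define H where "H = (harm (p + n) :: complex)"
  have c: "c \<noteq> 0"
    using assms(2) by (auto simp: c_def algebra_simps add_eq_0_iff)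
  have q: "q \<noteq> 0"
    unfolding q_def by (metis of_nat_Suc of_nat_neq_0 add.commute)
  have m: "m \<noteq> 0"
    unfolding m_def by (rule of_nat_neq_0)
  \<comment> \<open>\<open>D\<close> is an ordinary binomial coefficient with lower index at most
    the upper one.\<close>
  have D: "D \<noteq> 0"
    unfolding D_def binomial_gbinomial[symmetric] by simp
  \<comment> \<open>The upper argument is already that of \<open>B\<close>, so only the lower index
    rises; in \<open>numer\<close> and \<open>denom\<close> both rise.\<close>
  have summand: "(x + of_nat (Suc n)) gchoose Suc n = (x + 1) / m * B"
    using gbinomial_Suc_ratio[of "x + of_nat n + 1" n] by (simp add: B_def m_def add_ac)
  \<comment> \<open>The factor x + n + 2 is split as \<open>c + q\<close>, which makes the quotient
    by \<open>denom\<close> equal to (1 + c/q) B/D.\<close>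
  have numer: "(x + of_nat (Suc n) + 1) gchoose Suc n = (c + q) / m * B"
    using gbinomial_absorption_ratio[of "x + of_nat n + 1" n]
    by (simp add: B_def m_def c_def q_def add_ac)
  have denom: "of_nat (p + Suc n) gchoose Suc n = q / m * D"
    using gbinomial_absorption_ratio[of "of_nat (p + n) :: complex" n]
    by (simp add: D_def m_def q_def add_ac)
  have harm: "harm (p + Suc n) = H + 1 / q"
    by (simp add: H_def q_def harm_Suc field_simps)
  have "(\<Sum>k=1..Suc n. ((x + of_nat k) gchoose k) / (of_nat (p + k) gchoose k) * harm (p + k)) =
      (x + 1) / c * (B / D * (H - 1 / c) - harm p + 1 / c)
        + (x + 1) / m * B / (q / m * D) * (H + 1 / q)"
    using Suc.IH unfolding summand[symmetric] denom[symmetric] harm[symmetric]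
    by (simp add: B_def D_def H_def c_def add_ac)
  \<comment> \<open>After cancelling (x + 1)/c and B/D this says (1 + c/q)(H + 1/q - 1/c) - (H -
    1/c) = (c/q)(H + 1/q): the increment 1/q of \<open>H\<close> cancels against (c/q)(1/c), which
    is the purpose of the correction 1/c.\<close>
  also have "\<dots> = (x + 1) / c *
      ((c + q) / m * B / (q / m * D) * (H + 1 / q - 1 / c) - harm p + 1 / c)"
    using c q m D by (simp add: field_simps)
  finally show ?case
    unfolding numer denom harm c_def .
qed

end
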